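(* There are no admissible vectors for diagrams in any of the extended affine skew-symmetrizable mutation classes $G_2^{( *,+)}$, $G_2^{( *,* )}$, $F_4^{( *,+)}$, $F_4^{( *,* )}$.
   Context: $G_2^{( *,+)}$, $G_2^{( *,* )}$, $F_4^{( *,+)}$, $F_4^{( *,* )}$ denote the four exceptional non-skew-symmetric mutation-finite classes of extended affine (elliptic) type in the classification of Felikson–Shapiro–Tumarkin ("Skew-symmetric cluster algebras of finite mutation type"/"Cluster algebras of finite mutation type via unfoldings"). For a skew-symmetrizable $n\times n$ matrix $B$ (with $BD$ skew-symmetric for a positive integer diagonal $D$) and $\boldsymbol b\in\mathbb Z^n$, form the $(n+1)\times n$ matrix $\widetilde B$ consisting of $B$ with extra last row $-\boldsymbol b$; mutation $\mu_k$ ($1\le k\le n$): $b'_{ij}=-b_{ij}$ if $k\in\{i,j\}$, else $b'_{ij}=b_{ij}+\mathrm{sgn}(b_{ik})[b_{ik}b_{kj}]_+$. $\boldsymbol b$ is admissible (for $B$, or its diagram) if $\boldsymbol b\ne0$ and the mutation class of $\widetilde B$ is finite. The diagram of $B$ has an arrow $v_i\to v_j$ of weight $|b_{ij}b_{ji}|$ whenever $b_{ij}>0$. *)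

theory Defs
  imports "Jordan_Normal_Form.Matrix"
begin

text \<open>Indices are 0-based. A mutable index is a column index, so an extended \<open>(n+1) \<times> n\<close> matrix
  is mutated only at \<open>k < n\<close>, and its last row \<open>n\<close> is frozen.\<close>

definition skew_symmetrizable :: "int mat \<Rightarrow> bool" where
  "skew_symmetrizable B \<longleftrightarrow> square_mat B \<and>
     (\<exists>D \<in> carrier_mat (dim_row B) (dim_row B).
        diagonal_mat D \<and> (\<forall>i < dim_row B. D $$ (i,i) > 0) \<and>
        transpose_mat (B * D) = - (B * D))"

definition mutate :: "nat \<Rightarrow> int mat \<Rightarrow> int mat" where
  "mutate k M = mat (dim_row M) (dim_col M) (\<lambda>(i,j).
     if i = k \<or> j = k then - M $$ (i,j)
     else M $$ (i,j) + sgn (M $$ (i,k)) * max 0 (M $$ (i,k) * M $$ (k,j)))"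

inductive_set mutation_class :: "int mat \<Rightarrow> int mat set" for M :: "int mat" where
  self: "M \<in> mutation_class M"
| step: "A \<in> mutation_class M \<Longrightarrow> k < dim_col A \<Longrightarrow> mutate k A \<in> mutation_class M"

definition admissible :: "int mat \<Rightarrow> int vec \<Rightarrow> bool" where
  "admissible B b \<longleftrightarrow> b \<in> carrier_vec (dim_col B) \<and> b \<noteq> 0\<^sub>v (dim_col B) \<and>
     finite (mutation_class (B @\<^sub>r mat_of_row (- b)))"

text \<open>A diagram on the vertices \<open>0, \<dots>, n - 1\<close> is the pair of \<open>n\<close> and its set of arrows;
  \<open>(i, j, w)\<close> stands for an arrow from \<open>i\<close> to \<open>j\<close> of weight \<open>w\<close>.\<close>

type_synonym diagram = "nat \<times> (nat \<times> nat \<times> int) set"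

definition diagram_of :: "int mat \<Rightarrow> diagram" where
  "diagram_of B = (dim_row B,
     {(i, j, \<bar>B $$ (i,j) * B $$ (j,i)\<bar>) | i j. i < dim_row B \<and> j < dim_row B \<and> B $$ (i,j) > 0})"

definition diagram_iso :: "diagram \<Rightarrow> diagram \<Rightarrow> bool" where
  "diagram_iso \<Gamma> \<Delta> \<longleftrightarrow> (\<exists>\<pi>. bij_betw \<pi> {..<fst \<Gamma>} {..<fst \<Delta>} \<and>
     snd \<Delta> = (\<lambda>(i, j, w). (\<pi> i, \<pi> j, w)) ` snd \<Gamma>)"

text \<open>Mutation of diagrams is the one induced by mutation of skew-symmetrizable matrices, and
  diagrams are considered up to relabelling of the vertices.\<close>

definition diagram_mutation_class :: "diagram \<Rightarrow> diagram set" where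
  "diagram_mutation_class \<Gamma> =
     {diagram_of A | A B. skew_symmetrizable B \<and> diagram_iso (diagram_of B) \<Gamma> \<and>
        A \<in> mutation_class B}"

text \<open>Each representative consists of an arrow \<open>0 \<rightarrow> 1\<close> of weight 4, oriented triangles on this
  arrow, and tails of weight 1 attached to the third vertices of the triangles. The names follow
  Saito's extended affine root systems: \<open>(*,*)\<close> covers the types \<open>(1,1)\<close> and \<open>(t,t)\<close>, and \<open>(*,+)\<close>
  covers \<open>(1,t)\<close> and \<open>(t,1)\<close>, where \<open>t = 3\<close> for \<open>G\<^sub>2\<close> and \<open>t = 2\<close> for \<open>F\<^sub>4\<close>. The two types of a
  class correspond to the two choices of symmetrizer (up to scaling) compatible with the diagram,
  and the representatives are the foldings of the tubular quivers \<open>E\<^sub>6\<^sup>(\<^sup>1\<^sup>,\<^sup>1\<^sup>)\<close> (for \<open>G\<^sub>2\<^sup>(\<^sup>*\<^sup>,\<^sup>+\<^sup>)\<close>),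
  \<open>D\<^sub>4\<^sup>(\<^sup>1\<^sup>,\<^sup>1\<^sup>)\<close> (for \<open>G\<^sub>2\<^sup>(\<^sup>*\<^sup>,\<^sup>*\<^sup>)\<close>), \<open>E\<^sub>7\<^sup>(\<^sup>1\<^sup>,\<^sup>1\<^sup>)\<close> (for \<open>F\<^sub>4\<^sup>(\<^sup>*\<^sup>,\<^sup>+\<^sup>)\<close>) and \<open>E\<^sub>6\<^sup>(\<^sup>1\<^sup>,\<^sup>1\<^sup>)\<close>
  (for \<open>F\<^sub>4\<^sup>(\<^sup>*\<^sup>,\<^sup>*\<^sup>)\<close>).\<close>

definition G2_star_plus :: "diagram set" where
  "G2_star_plus = diagram_mutation_class
     (4, {(0,1,4), (1,2,3), (2,0,3), (2,3,1)})"

definition G2_star_star :: "diagram set" where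
  "G2_star_star = diagram_mutation_class
     (4, {(0,1,4), (1,2,1), (2,0,1), (1,3,3), (3,0,3)})"

definition F4_star_plus :: "diagram set" where
  "F4_star_plus = diagram_mutation_class
     (6, {(0,1,4), (1,2,1), (2,0,1), (1,3,2), (3,0,2), (3,4,1), (4,5,1)})"

definition F4_star_star :: "diagram set" where
  "F4_star_star = diagram_mutation_class
     (6, {(0,1,4), (1,2,1), (2,0,1), (2,3,1), (1,4,2), (4,0,2), (4,5,1)})"

end

theory Submission
  imports Defs
begin

text \<open>If the principal part has an arrow \<open>i \<rightarrow> j\<close> with entries \<open>2\<close> and \<open>-2\<close>, then mutating
  alternately at \<open>i\<close> and \<open>j\<close> makes the frozen row grow linearly unless its entries satisfy
  \<open>x\<^sub>j = - x\<^sub>i \<le> 0\<close>. In each of the four classes, imposing this condition at the arrow \<open>0 \<rightarrow> 1\<close> of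
  the representative and at one further double arrow, reached by a short sequence of mutations,
  already forces the frozen row to vanish. Two skew-symmetrizable matrices with the same diagram
  differ by conjugation with a positive real diagonal matrix, and such a conjugation commutes with
  mutation and preserves boundedness of the frozen row. This reduces every matrix of a class to
  one fixed matrix with a real frozen row.\<close>

section \<open>Mutation of real matrices stored as lists of rows\<close>

text \<open>Mutation of a real \<open>(n+1) \<times> n\<close> matrix given by its list of rows, the last one frozen. The
  sign-split form of the mutation rule is linear in column \<open>k\<close> up to \<open>max\<close> and \<open>min\<close>, so that it
  simplifies to linear arithmetic when the principal part is numeric.\<close>

definition mut_rows :: "nat \<Rightarrow> real list list \<Rightarrow> real list list" where
  "mut_rows k L = map (\<lambda>i. map (\<lambda>j.
       if i = k \<or> j = k then - L ! i ! j
       else L ! i ! j + (if 0 < L ! k ! j then L ! k ! j * max 0 (L ! i ! k)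
                         else - (L ! k ! j * min 0 (L ! i ! k))))
     [0..<length L - 1]) [0..<length L]"

lemma length_mut_rows [simp]: "length (mut_rows k L) = length L"
  by (simp add: mut_rows_def)

lemma length_fold_mut_rows [simp]: "length (fold mut_rows ks L) = length L"
  by (induction ks arbitrary: L) auto

lemma mut_rows_nth:
  assumes "i < length L" "j < length L - 1"
  shows "mut_rows k L ! i ! j = (if i = k \<or> j = k then - L ! i ! j
       else L ! i ! j + (if 0 < L ! k ! j then L ! k ! j * max 0 (L ! i ! k)
                         else - (L ! k ! j * min 0 (L ! i ! k))))"
  using assms by (simp add: mut_rows_def del: upt_Suc)

definition row_bounded :: "real \<Rightarrow> real list list \<Rightarrow> bool" where
  "row_bounded C L \<longleftrightarrow> (\<forall>ks j. set ks \<subseteq> {..<length L - 1} \<longrightarrow> j < length L - 1 \<longrightarrow>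
     \<bar>fold mut_rows ks L ! (length L - 1) ! j\<bar> \<le> C)"

lemma row_bounded_mut_rows:
  assumes "row_bounded C L" "k < length L - 1"
  shows "row_bounded C (mut_rows k L)"
  unfolding row_bounded_def
proof (intro allI impI)
  fix ks j
  assume "set ks \<subseteq> {..<length (mut_rows k L) - 1}" "j < length (mut_rows k L) - 1"
  then show "\<bar>fold mut_rows ks (mut_rows k L) ! (length (mut_rows k L) - 1) ! j\<bar> \<le> C"
    using assms unfolding row_bounded_def by (auto dest!: spec[of _ "k # ks"])
qed

lemma row_boundedD:
  assumes "row_bounded C L" "j < length L - 1"
  shows "\<bar>L ! (length L - 1) ! j\<bar> \<le> C"
  using assms unfolding row_bounded_def by (auto dest!: spec[of _ "[]"])

text \<open>Mutating at \<open>i\<close> and then at \<open>j\<close> restores the two entries and the sum \<open>x\<^sub>i + x\<^sub>j\<close>, while \<open>x\<^sub>i\<close>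
  increases by twice this sum. The sign \<open>s\<close> covers both orientations of the arrow.\<close>

lemma double_arrow_growth:
  fixes s d C :: real
  assumes "row_bounded C L" "length L = Suc n" "i < n" "j < n" "i \<noteq> j" "s = 1 \<or> s = -1"
    and "L ! i ! j = 2 * s" "L ! j ! i = - 2 * s"
    and "0 \<le> s * L ! n ! i" "0 < d" "d \<le> s * (L ! n ! i + L ! n ! j)"
  shows "s * L ! n ! i + 2 * real m * d \<le> C"
  using assms
proof (induction m arbitrary: L)
  case 0
  then show ?case using row_boundedD[of C L i] by auto
next
  case (Suc m)
  define L1 where "L1 = mut_rows i L"
  define L2 where "L2 = mut_rows j L1"
  have len: "length L1 = Suc n" "length L2 = Suc n"
    using Suc.prems by (auto simp: L1_def L2_def)
  have bnd: "row_bounded C L2"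
    unfolding L2_def L1_def using Suc.prems by (intro row_bounded_mut_rows) auto
  have L1: "L1 ! i ! j = - 2 * s" "L1 ! j ! i = 2 * s" "L1 ! n ! i = - L ! n ! i"
      "s * L1 ! n ! j = s * (L ! n ! j + 2 * L ! n ! i)"
    using Suc.prems by (auto simp: L1_def mut_rows_nth)
  \<comment> \<open>This quantity is \<open>s * (L ! n ! i + L ! n ! j) \<ge> d\<close> plus
    \<open>s * L ! n ! i \<ge> 0\<close>. Its sign ensures that \<open>max\<close> and
    \<open>min\<close> do not truncate in the mutation at \<open>j\<close>.\<close>
  have "0 \<le> s * L1 ! n ! j"
    using L1(4) Suc.prems(9-11) by (simp add: algebra_simps)
  then have L2: "L2 ! i ! j = 2 * s" "L2 ! j ! i = - 2 * s" "L2 ! n ! j = - L1 ! n ! j"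
      "s * L2 ! n ! i = s * (L1 ! n ! i + 2 * L1 ! n ! j)"
    using Suc.prems(3-6) L1(1,2) len by (auto simp: L2_def mut_rows_nth)
  have "s * L2 ! n ! i = s * L ! n ! i + 2 * (s * (L ! n ! i + L ! n ! j))"
    using L1(3,4) L2(4) by (simp add: algebra_simps)
  moreover have "s * (L2 ! n ! i + L2 ! n ! j) = s * (L ! n ! i + L ! n ! j)"
    using L1(3,4) L2(3,4) by (simp add: algebra_simps)
  moreover have "s * L2 ! n ! i + 2 * real m * d \<le> C"
    using Suc.prems(3-6,9-11) L2(1,2) len bnd calculation by (intro Suc.IH) auto
  ultimately show ?case using Suc.prems(11) by (simp add: algebra_simps)
qed

lemma not_double_arrow_growth:
  fixes s C :: real
  assumes "row_bounded C L" "length L = Suc n" "i < n" "j < n" "i \<noteq> j" "s = 1 \<or> s = -1"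
    and "L ! i ! j = 2 * s" "L ! j ! i = - 2 * s" "0 \<le> s * L ! n ! i"
  shows "s * (L ! n ! i + L ! n ! j) \<le> 0"
proof (rule ccontr)
  define d where "d = s * (L ! n ! i + L ! n ! j)"
  assume "\<not> s * (L ! n ! i + L ! n ! j) \<le> 0"
  then have "0 < d" by (simp add: d_def)
  then obtain m where "C < real m * d"
    using reals_Archimedean3 by blast
  moreover have "s * L ! n ! i + 2 * real m * d \<le> C"
    by (rule double_arrow_growth[OF assms \<open>0 < d\<close>]) (simp add: d_def)
  moreover have "0 \<le> real m * d" using \<open>0 < d\<close> by simp
  ultimately show False using assms(9) by linarith
qed

lemma double_arrow_row:
  fixes C :: real
  assumes "row_bounded C L" "length L = Suc n" "i < n" "j < n" "i \<noteq> j"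
    and "L ! i ! j = 2" "L ! j ! i = - 2"
  shows "0 \<le> L ! n ! i \<and> L ! n ! j = - L ! n ! i"
proof -
  define L1 where "L1 = mut_rows i L"
  have bnd: "row_bounded C L1" and len: "length L1 = Suc n"
    unfolding L1_def using assms by (auto intro: row_bounded_mut_rows)
  have L1: "L1 ! i ! j = - 2" "L1 ! j ! i = 2" "L1 ! n ! i = - L ! n ! i"
      "L1 ! n ! j = L ! n ! j + 2 * max 0 (L ! n ! i)"
    using assms by (auto simp: L1_def mut_rows_nth)
  have "0 \<le> L ! n ! i \<Longrightarrow> L ! n ! i + L ! n ! j \<le> 0"
    using not_double_arrow_growth[OF assms(1-5), of 1] assms by auto
  moreover have "L ! n ! j \<le> 0 \<Longrightarrow> 0 \<le> L ! n ! i + L ! n ! j"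
    using not_double_arrow_growth[OF assms(1,2,4,3) assms(5)[symmetric], of "-1"] assms by auto
  moreover have "0 \<le> L1 ! n ! j \<Longrightarrow> L1 ! n ! i + L1 ! n ! j \<le> 0"
    using not_double_arrow_growth[OF bnd len assms(4,3) assms(5)[symmetric], of 1] L1 by auto
  moreover have "L1 ! n ! i \<le> 0 \<Longrightarrow> 0 \<le> L1 ! n ! i + L1 ! n ! j"
    using not_double_arrow_growth[OF bnd len assms(3-5), of "-1"] L1 by auto
  ultimately show ?thesis using L1 by linarith
qed

section \<open>Rigidity of the four representatives\<close>

definition rigid :: "int list list \<Rightarrow> bool" where
  "rigid R \<longleftrightarrow> (\<forall>C xs. length xs = length R \<longrightarrow>
     row_bounded C (map (map real_of_int) R @ [xs]) \<longrightarrow> (\<forall>x \<in> set xs. x = 0))"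

text \<open>The mutation sequences in the next four proofs were found by computer search.\<close>

lemma rigid_G2_star_plus: "rigid [[0, 2, -3, 0], [-2, 0, 3, 0], [1, -1, 0, 1], [0, 0, -1, 0]]"
  unfolding rigid_def
proof (intro allI impI)
  fix C and xs :: "real list"
  let ?R = "[[0, 2, -3, 0], [-2, 0, 3, 0], [1, -1, 0, 1], [0, 0, -1, 0]] :: int list list"
  assume "length xs = length ?R" and bounded: "row_bounded C (map (map real_of_int) ?R @ [xs])"
  then obtain x0 x1 x2 x3 where xs: "xs = [x0, x1, x2, x3]"
    by (auto simp: length_Suc_conv)
  have b0: "row_bounded C [[0, 2, -3, 0], [-2, 0, 3, 0], [1, -1, 0, 1], [0, 0, -1, 0], [x0, x1, x2, x3]]"
    using bounded by (simp add: xs)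
  have arrow: "0 \<le> x0" "x1 = - x0"
    using double_arrow_row[OF b0, of 4 0 1] by simp_all
  define y2 where "y2 = x2 + min 0 x3"
  have b1: "row_bounded C [[0, 2, -3, 0], [-2, 0, 3, 0], [1, -1, 0, -1], [0, 0, 1, 0], [x0, x1, y2, - x3]]"
    using row_bounded_mut_rows[OF b0, of 3] by (simp add: mut_rows_def upt_rec y2_def)
  define y0 where "y0 = x0 + max 0 y2"
  define y1 where "y1 = x1 + min 0 y2"
  define y3 where "y3 = - x3 + min 0 y2"
  have b2: "row_bounded C [[0, -1, 3, -3], [1, 0, -3, 0], [-1, 1, 0, 1], [1, 0, -1, 0], [y0, y1, - y2, y3]]"
    using row_bounded_mut_rows[OF b1, of 2] by (simp add: mut_rows_def upt_rec y0_def y1_def y3_def)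
  define z1 where "z1 = y1 + min 0 y0"
  define z2 where "z2 = - y2 + 3 * max 0 y0"
  define z3 where "z3 = y3 + 3 * min 0 y0"
  have b3: "row_bounded C [[0, 1, -3, 3], [-1, 0, 0, 0], [1, 0, 0, -2], [-1, 0, 2, 0], [- y0, z1, z2, z3]]"
    using row_bounded_mut_rows[OF b2, of 0] by (simp add: mut_rows_def upt_rec z1_def z2_def z3_def)
  have arrow': "0 \<le> z3" "z2 = - z3"
    using double_arrow_row[OF b3, of 4 3 2] by simp_all
  \<comment> \<open>Since \<open>y0 \<ge> x0 \<ge> 0\<close>, one has
    \<open>z2 = 3 * y0 - y2\<close>, and \<open>z2 \<le> 0\<close> forces
    \<open>x0 = y2 = 0\<close>. Then \<open>z2 = 0\<close>, so \<open>z3 = - x3\<close> vanishes,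
    and \<open>y2 = 0\<close> leaves \<open>x2 = 0\<close>.\<close>
  have "x0 = 0 \<and> x1 = 0 \<and> x2 = 0 \<and> x3 = 0"
    using arrow arrow' y2_def y0_def y1_def y3_def z1_def z2_def z3_def
    by (smt (z3))
  then show "\<forall>x \<in> set xs. x = 0" by (simp add: xs)
qed

lemma rigid_G2_star_star: "rigid [[0, 2, -1, -3], [-2, 0, 1, 3], [1, -1, 0, 0], [1, -1, 0, 0]]"
  unfolding rigid_def
proof (intro allI impI)
  fix C and xs :: "real list"
  let ?R = "[[0, 2, -1, -3], [-2, 0, 1, 3], [1, -1, 0, 0], [1, -1, 0, 0]] :: int list list"
  assume "length xs = length ?R" and bounded: "row_bounded C (map (map real_of_int) ?R @ [xs])"
  then obtain x0 x1 x2 x3 where xs: "xs = [x0, x1, x2, x3]"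
    by (auto simp: length_Suc_conv)
  have b0: "row_bounded C [[0, 2, -1, -3], [-2, 0, 1, 3], [1, -1, 0, 0], [1, -1, 0, 0], [x0, x1, x2, x3]]"
    using bounded by (simp add: xs)
  have arrow: "0 \<le> x0" "x1 = - x0"
    using double_arrow_row[OF b0, of 4 0 1] by simp_all
  define y0 where "y0 = x0 + max 0 x2"
  define y1 where "y1 = x1 + min 0 x2"
  have b1: "row_bounded C [[0, 1, 1, -3], [-1, 0, -1, 3], [-1, 1, 0, 0], [1, -1, 0, 0], [y0, y1, - x2, x3]]"
    using row_bounded_mut_rows[OF b0, of 2] by (simp add: mut_rows_def upt_rec y0_def y1_def)
  define z0 where "z0 = y0 + max 0 x3"
  define z1 where "z1 = y1 + min 0 x3"
  have b2: "row_bounded C [[0, -2, 1, 3], [2, 0, -1, -3], [-1, 1, 0, 0], [-1, 1, 0, 0], [z0, z1, - x2, - x3]]"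
    using row_bounded_mut_rows[OF b1, of 3] by (simp add: mut_rows_def upt_rec z0_def z1_def)
  have arrow': "0 \<le> z1" "z0 = - z1"
    using double_arrow_row[OF b2, of 4 1 0] by simp_all
  \<comment> \<open>\<open>z0\<close> is \<open>x0\<close> plus the positive parts of
    \<open>x2\<close> and \<open>x3\<close>, all nonnegative, while the reversed arrow gives
    \<open>z0 \<le> 0\<close>. Hence all three vanish, and \<open>z1 = 0\<close> kills the negative
    parts.\<close>
  have "x0 = 0 \<and> x1 = 0 \<and> x2 = 0 \<and> x3 = 0"
    using arrow arrow' y0_def y1_def z0_def z1_def
    by (smt (z3))
  then show "\<forall>x \<in> set xs. x = 0" by (simp add: xs)
qed

lemma rigid_F4_star_plus: "rigid [[0, 2, -1, -2, 0, 0], [-2, 0, 1, 2, 0, 0], [1, -1, 0, 0, 0, 0], [1, -1, 0, 0, 1, 0], [0, 0, 0, -1, 0, 1], [0, 0, 0, 0, -1, 0]]"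
  unfolding rigid_def
proof (intro allI impI)
  fix C and xs :: "real list"
  let ?R = "[[0, 2, -1, -2, 0, 0], [-2, 0, 1, 2, 0, 0], [1, -1, 0, 0, 0, 0], [1, -1, 0, 0, 1, 0], [0, 0, 0, -1, 0, 1], [0, 0, 0, 0, -1, 0]] :: int list list"
  assume "length xs = length ?R" and bounded: "row_bounded C (map (map real_of_int) ?R @ [xs])"
  then obtain x0 x1 x2 x3 x4 x5 where xs: "xs = [x0, x1, x2, x3, x4, x5]"
    by (auto simp: length_Suc_conv)
  have b0: "row_bounded C [[0, 2, -1, -2, 0, 0], [-2, 0, 1, 2, 0, 0], [1, -1, 0, 0, 0, 0], [1, -1, 0, 0, 1, 0], [0, 0, 0, -1, 0, 1], [0, 0, 0, 0, -1, 0], [x0, x1, x2, x3, x4, x5]]"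
    using bounded by (simp add: xs)
  have arrow: "0 \<le> x0" "x1 = - x0"
    using double_arrow_row[OF b0, of 6 0 1] by simp_all
  define y0 where "y0 = x0 + max 0 x3"
  define y1 where "y1 = x1 + min 0 x3"
  define y4 where "y4 = x4 + max 0 x3"
  have b1: "row_bounded C [[0, 0, -1, 2, 0, 0], [0, 0, 1, -2, 2, 0], [1, -1, 0, 0, 0, 0], [-1, 1, 0, 0, -1, 0], [0, -1, 0, 1, 0, 1], [0, 0, 0, 0, -1, 0], [y0, y1, x2, - x3, y4, x5]]"
    using row_bounded_mut_rows[OF b0, of 3] by (simp add: mut_rows_def upt_rec y0_def y1_def y4_def)
  define y2 where "y2 = x2 + max 0 y1"
  define y3 where "y3 = - x3 + 2 * min 0 y1"
  define z4 where "z4 = y4 + 2 * max 0 y1"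
  have b2: "row_bounded C [[0, 0, -1, 2, 0, 0], [0, 0, -1, 2, -2, 0], [1, 1, 0, -2, 0, 0], [-1, -1, 1, 0, 1, 0], [0, 1, 0, -1, 0, 1], [0, 0, 0, 0, -1, 0], [y0, - y1, y2, y3, z4, x5]]"
    using row_bounded_mut_rows[OF b1, of 1] by (simp add: mut_rows_def upt_rec y2_def y3_def z4_def)
  define z1 where "z1 = - y1 + max 0 z4"
  define z3 where "z3 = y3 + min 0 z4"
  define y5 where "y5 = x5 + max 0 z4"
  have b3: "row_bounded C [[0, 0, -1, 2, 0, 0], [0, 0, -1, 0, 2, 0], [1, 1, 0, -2, 0, 0], [-1, 0, 1, 0, -1, 1], [0, -1, 0, 1, 0, -1], [0, 0, 0, -1, 1, 0], [y0, z1, y2, z3, - z4, y5]]"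
    using row_bounded_mut_rows[OF b2, of 4] by (simp add: mut_rows_def upt_rec z1_def z3_def y5_def)
  define z2 where "z2 = y2 + min 0 z1"
  define u4 where "u4 = - z4 + 2 * max 0 z1"
  have b4: "row_bounded C [[0, 0, -1, 2, 0, 0], [0, 0, 1, 0, -2, 0], [1, -1, 0, -2, 2, 0], [-1, 0, 1, 0, -1, 1], [0, 1, -1, 1, 0, -1], [0, 0, 0, -1, 1, 0], [y0, - z1, z2, z3, u4, y5]]"
    using row_bounded_mut_rows[OF b3, of 1] by (simp add: mut_rows_def upt_rec z2_def u4_def)
  define z0 where "z0 = y0 + max 0 z2"
  define u1 where "u1 = - z1 + min 0 z2"
  define u3 where "u3 = z3 + 2 * min 0 z2"
  define v4 where "v4 = u4 + 2 * max 0 z2"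
  have b5: "row_bounded C [[0, -1, 1, 0, 0, 0], [1, 0, -1, 0, 0, 0], [-1, 1, 0, 2, -2, 0], [0, 0, -1, 0, 1, 1], [0, 0, 1, -1, 0, -1], [0, 0, 0, -1, 1, 0], [z0, u1, - z2, u3, v4, y5]]"
    using row_bounded_mut_rows[OF b4, of 2] by (simp add: mut_rows_def upt_rec z0_def u1_def u3_def v4_def)
  define v3 where "v3 = u3 + min 0 y5"
  define w4 where "w4 = v4 + max 0 y5"
  have b6: "row_bounded C [[0, -1, 1, 0, 0, 0], [1, 0, -1, 0, 0, 0], [-1, 1, 0, 2, -2, 0], [0, 0, -1, 0, 2, -1], [0, 0, 1, -2, 0, 1], [0, 0, 0, 1, -1, 0], [z0, u1, - z2, v3, w4, - y5]]"
    using row_bounded_mut_rows[OF b5, of 5] by (simp add: mut_rows_def upt_rec v3_def w4_def)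
  have arrow': "0 \<le> v3" "w4 = - v3"
    using double_arrow_row[OF b6, of 6 3 4] by simp_all
  \<comment> \<open>The signs \<open>y1 \<le> 0 \<le> z1\<close> give
    \<open>w4 = \<bar>z4\<bar> - 2 * y1 + 2 * max 0 x2 + max 0 y5\<close>, a sum of nonnegative
    terms. As \<open>w4 = - v3 \<le> 0\<close>, they all vanish; then \<open>v3 = 0\<close> kills
    \<open>x3\<close> and the negative parts of \<open>x2\<close> and \<open>y5\<close>.\<close>
  have "x0 = 0 \<and> x1 = 0 \<and> x2 = 0 \<and> x3 = 0 \<and> x4 = 0 \<and> x5 = 0"
    using arrow arrow' y0_def y1_def y4_def y2_def y3_def z4_def z1_def z3_def y5_def z2_def u4_def z0_def u1_def u3_def v4_def v3_def w4_def
    by (smt (z3))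
  then show "\<forall>x \<in> set xs. x = 0" by (simp add: xs)
qed

lemma rigid_F4_star_star: "rigid [[0, 2, -1, 0, -2, 0], [-2, 0, 1, 0, 2, 0], [1, -1, 0, 1, 0, 0], [0, 0, -1, 0, 0, 0], [1, -1, 0, 0, 0, 1], [0, 0, 0, 0, -1, 0]]"
  unfolding rigid_def
proof (intro allI impI)
  fix C and xs :: "real list"
  let ?R = "[[0, 2, -1, 0, -2, 0], [-2, 0, 1, 0, 2, 0], [1, -1, 0, 1, 0, 0], [0, 0, -1, 0, 0, 0], [1, -1, 0, 0, 0, 1], [0, 0, 0, 0, -1, 0]] :: int list list"
  assume "length xs = length ?R" and bounded: "row_bounded C (map (map real_of_int) ?R @ [xs])"
  then obtain x0 x1 x2 x3 x4 x5 where xs: "xs = [x0, x1, x2, x3, x4, x5]"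
    by (auto simp: length_Suc_conv)
  have b0: "row_bounded C [[0, 2, -1, 0, -2, 0], [-2, 0, 1, 0, 2, 0], [1, -1, 0, 1, 0, 0], [0, 0, -1, 0, 0, 0], [1, -1, 0, 0, 0, 1], [0, 0, 0, 0, -1, 0], [x0, x1, x2, x3, x4, x5]]"
    using bounded by (simp add: xs)
  have arrow: "0 \<le> x0" "x1 = - x0"
    using double_arrow_row[OF b0, of 6 0 1] by simp_all
  define y0 where "y0 = x0 + max 0 x4"
  define y1 where "y1 = x1 + min 0 x4"
  define y5 where "y5 = x5 + max 0 x4"
  have b1: "row_bounded C [[0, 0, -1, 0, 2, 0], [0, 0, 1, 0, -2, 2], [1, -1, 0, 1, 0, 0], [0, 0, -1, 0, 0, 0], [-1, 1, 0, 0, 0, -1], [0, -1, 0, 0, 1, 0], [y0, y1, x2, x3, - x4, y5]]"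
    using row_bounded_mut_rows[OF b0, of 4] by (simp add: mut_rows_def upt_rec y0_def y1_def y5_def)
  define z1 where "z1 = y1 + min 0 y5"
  define y4 where "y4 = - x4 + max 0 y5"
  have b2: "row_bounded C [[0, 0, -1, 0, 2, 0], [0, 0, 1, 0, 0, -2], [1, -1, 0, 1, 0, 0], [0, 0, -1, 0, 0, 0], [-1, 0, 0, 0, 0, 1], [0, 1, 0, 0, -1, 0], [y0, z1, x2, x3, y4, - y5]]"
    using row_bounded_mut_rows[OF b1, of 5] by (simp add: mut_rows_def upt_rec z1_def y4_def)
  define y2 where "y2 = x2 + max 0 z1"
  define z5 where "z5 = - y5 + 2 * min 0 z1"
  have b3: "row_bounded C [[0, 0, -1, 0, 2, 0], [0, 0, -1, 0, 0, 2], [1, 1, 0, 1, 0, -2], [0, 0, -1, 0, 0, 0], [-1, 0, 0, 0, 0, 1], [0, -1, 1, 0, -1, 0], [y0, - z1, y2, x3, y4, z5]]"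
    using row_bounded_mut_rows[OF b2, of 1] by (simp add: mut_rows_def upt_rec y2_def z5_def)
  define z0 where "z0 = y0 + max 0 y2"
  define u1 where "u1 = - z1 + max 0 y2"
  define y3 where "y3 = x3 + max 0 y2"
  define u5 where "u5 = z5 + 2 * min 0 y2"
  have b4: "row_bounded C [[0, 0, 1, 0, 2, -2], [0, 0, 1, 0, 0, 0], [-1, -1, 0, -1, 0, 2], [0, 0, 1, 0, 0, -2], [-1, 0, 0, 0, 0, 1], [1, 0, -1, 1, -1, 0], [z0, u1, - y2, y3, y4, u5]]"
    using row_bounded_mut_rows[OF b3, of 2] by (simp add: mut_rows_def upt_rec z0_def u1_def y3_def u5_def)
  define z2 where "z2 = - y2 + max 0 z0"
  define z4 where "z4 = y4 + 2 * max 0 z0"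
  define v5 where "v5 = u5 + 2 * min 0 z0"
  have b5: "row_bounded C [[0, 0, -1, 0, -2, 2], [0, 0, 1, 0, 0, 0], [1, -1, 0, -1, 0, 0], [0, 0, 1, 0, 0, -2], [1, 0, 0, 0, 0, -1], [-1, 0, 0, 1, 1, 0], [- z0, u1, z2, y3, z4, v5]]"
    using row_bounded_mut_rows[OF b4, of 0] by (simp add: mut_rows_def upt_rec z2_def z4_def v5_def)
  define u0 where "u0 = - z0 + min 0 v5"
  define z3 where "z3 = y3 + max 0 v5"
  define u4 where "u4 = z4 + max 0 v5"
  have b6: "row_bounded C [[0, 0, -1, 2, 0, -2], [0, 0, 1, 0, 0, 0], [1, -1, 0, -1, 0, 0], [-2, 0, 1, 0, 0, 2], [0, 0, 0, 0, 0, 1], [1, 0, 0, -1, -1, 0], [u0, u1, z2, z3, u4, - v5]]"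
    using row_bounded_mut_rows[OF b5, of 5] by (simp add: mut_rows_def upt_rec u0_def z3_def u4_def)
  have arrow': "0 \<le> u0" "z3 = - u0"
    using double_arrow_row[OF b6, of 6 0 3] by simp_all
  \<comment> \<open>Since \<open>z0 \<ge> 0\<close>, the condition \<open>u0 \<ge> 0\<close> forces
    \<open>z0 = 0\<close> and \<open>v5 \<ge> 0\<close>. The former gives \<open>x0 = 0\<close>,
    \<open>x2 \<le> 0\<close> and \<open>x4 \<le> 0\<close>. Then
    \<open>v5 = 2 * x2 + 2 * x4 - \<bar>x5\<bar>\<close> has only nonpositive terms, so all vanish,
    and \<open>z3 = 0\<close> yields \<open>x3 = 0\<close>.\<close>
  have "x0 = 0 \<and> x1 = 0 \<and> x2 = 0 \<and> x3 = 0 \<and> x4 = 0 \<and> x5 = 0"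
    using arrow arrow' y0_def y1_def y5_def z1_def y4_def y2_def z5_def z0_def u1_def y3_def u5_def z2_def z4_def v5_def u0_def z3_def u4_def
    by (smt (z3))
  then show "\<forall>x \<in> set xs. x = 0" by (simp add: xs)
qed

section \<open>Symmetrizers and their invariance under mutation\<close>

text \<open>Stated for entry functions, so that it applies alike to matrices, to lists of rows and
  to matrices read through a relabelling.\<close>

definition symmetrizer :: "nat \<Rightarrow> (nat \<Rightarrow> int) \<Rightarrow> (nat \<Rightarrow> nat \<Rightarrow> int) \<Rightarrow> bool" where
  "symmetrizer n d a \<longleftrightarrow> (\<forall>i<n. 0 < d i) \<and> (\<forall>i<n. \<forall>j<n. a i j * d j = - (a j i * d i))"

lemma symmetrizer_sgn:
  assumes "symmetrizer n d a" "i < n" "j < n"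
  shows "sgn (a j i) = - sgn (a i j)"
proof -
  have "a i j * d j = - (a j i * d i)" "0 < d i" "0 < d j"
    using assms unfolding symmetrizer_def by blast+
  then have "sgn (a i j * d j) = sgn (- (a j i * d i))" by (simp only:)
  then show ?thesis using \<open>0 < d i\<close> \<open>0 < d j\<close> by (simp add: sgn_mult sgn_minus)
qed

lemma skew_symmetrizable_symmetrizer:
  assumes "skew_symmetrizable B"
  obtains d n where "dim_row B = n" "dim_col B = n" "symmetrizer n d (\<lambda>i j. B $$ (i, j))"
proof -
  define n where "n = dim_row B"
  from assms obtain D where D: "D \<in> carrier_mat n n" "diagonal_mat D" "\<forall>i<n. D $$ (i, i) > 0"
      "transpose_mat (B * D) = - (B * D)" and sq: "dim_col B = n"
    by (auto simp: skew_symmetrizable_def n_def)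
  have prod: "(B * D) $$ (i, j) = B $$ (i, j) * D $$ (j, j)" if "i < n" "j < n" for i j
  proof -
    have "(B * D) $$ (i, j) = (\<Sum>k<n. B $$ (i, k) * D $$ (k, j))"
      using that D(1) sq by (auto simp: n_def scalar_prod_def atLeast0LessThan)
    also have "\<dots> = (\<Sum>k<n. if k = j then B $$ (i, j) * D $$ (j, j) else 0)"
      using D(1,2) that by (intro sum.cong) (auto simp: diagonal_mat_def)
    also have "\<dots> = B $$ (i, j) * D $$ (j, j)" using that by simp
    finally show ?thesis .
  qed
  have "symmetrizer n (\<lambda>i. D $$ (i, i)) (\<lambda>i j. B $$ (i, j))"
    unfolding symmetrizer_def
  proof (intro conjI allI impI)
    fix i j assume ij: "i < n" "j < n"
    have "transpose_mat (B * D) $$ (j, i) = (- (B * D)) $$ (j, i)" by (simp only: D(4))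
    then have "(B * D) $$ (i, j) = - (B * D) $$ (j, i)"
      using ij D(1) by (auto simp: n_def)
    then show "B $$ (i, j) * D $$ (j, j) = - (B $$ (j, i) * D $$ (i, i))"
      using prod ij by simp
  qed (use D(3) in auto)
  with that sq show ?thesis by (auto simp: n_def)
qed

lemma dim_mutate [simp]: "dim_row (mutate k M) = dim_row M" "dim_col (mutate k M) = dim_col M"
  by (auto simp: mutate_def)

lemma mutate_nth:
  assumes "i < dim_row M" "j < dim_col M"
  shows "mutate k M $$ (i, j) = (if i = k \<or> j = k then - M $$ (i, j)
     else M $$ (i, j) + sgn (M $$ (i, k)) * max 0 (M $$ (i, k) * M $$ (k, j)))"
  using assms by (simp add: mutate_def)

text \<open>The second mutation sees the same product but the opposite sign of
  \<open>M $$ (i, k)\<close>, so it removes the correction added by the first.\<close>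

lemma mutate_involutive:
  assumes "k < dim_row M" "k < dim_col M"
  shows "mutate k (mutate k M) = M"
  by (rule eq_matI) (use assms in \<open>auto simp: mutate_nth sgn_minus\<close>)

lemma symmetrizer_mutate:
  assumes "symmetrizer n d (\<lambda>i j. B $$ (i, j))" "dim_row B = n" "dim_col B = n" "k < n"
  shows "symmetrizer n d (\<lambda>i j. mutate k B $$ (i, j))"
  unfolding symmetrizer_def
proof (intro conjI allI impI)
  fix i j assume ij: "i < n" "j < n"
  let ?b = "\<lambda>i j. B $$ (i, j)"
  have pos: "0 < d i" "0 < d j" "0 < d k"
    and eqs: "?b i j * d j = - (?b j i * d i)" "?b i k * d k = - (?b k i * d i)"
      "?b j k * d k = - (?b k j * d j)"
    using assms(1,4) ij unfolding symmetrizer_def by blast+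
  \<comment> \<open>In the product of the last two relations of \<open>eqs\<close> the signs cancel.
    After \<open>d k\<close> is cancelled, the paths through \<open>k\<close> in both directions are
    seen to have products of the same sign, so both corrections are active or neither is.\<close>
  have "?b j k * ?b k i * d i * d k = (?b j k * d k) * (?b k i * d i)" by (simp only: ac_simps)
  also have "\<dots> = (?b k j * d j) * (?b i k * d k)" using eqs(2,3) by simp
  finally have "?b j k * ?b k i * d i * d k = ?b i k * ?b k j * d j * d k" by (simp only: ac_simps)
  then have prod: "?b j k * ?b k i * d i = ?b i k * ?b k j * d j"
    using pos by simp
  have "sgn (?b i k) * max 0 (?b i k * ?b k j) * d j = - (sgn (?b j k) * max 0 (?b j k * ?b k i) * d i)"
  proof (cases "0 < ?b i k * ?b k j")
    case True
    then have "0 < ?b j k * ?b k i * d i" using prod pos by simp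
    then have "0 < ?b j k * ?b k i" using pos by (simp add: zero_less_mult_iff)
    moreover have "sgn (?b j k) = - sgn (?b i k)"
      using True symmetrizer_sgn[OF assms(1) assms(4) ij(2)]
      by (auto simp: zero_less_mult_iff)
    ultimately show ?thesis using True prod by (simp add: mult.assoc)
  next
    case False
    then have "\<not> 0 < ?b j k * ?b k i * d i" using prod pos by (simp add: zero_less_mult_iff)
    then have "\<not> 0 < ?b j k * ?b k i" using pos by (simp add: zero_less_mult_iff)
    then show ?thesis using False by simp
  qed
  then show "mutate k B $$ (i, j) * d j = - (mutate k B $$ (j, i) * d i)"
    using assms ij eqs(1) by (auto simp: mutate_nth algebra_simps)
qed (use assms in \<open>unfold symmetrizer_def, blast\<close>)

section \<open>Matrices with the same diagram\<close>

lemma symmetrizer_scaling: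
  fixes a b :: "nat \<Rightarrow> nat \<Rightarrow> int"
  assumes "symmetrizer n d a" "symmetrizer n d' b"
    and arrows: "\<And>i j w. i < n \<Longrightarrow> j < n \<Longrightarrow>
      0 < a i j \<and> w = \<bar>a i j * a j i\<bar> \<longleftrightarrow> 0 < b i j \<and> w = \<bar>b i j * b j i\<bar>"
  obtains e :: "nat \<Rightarrow> real" where "\<And>i. i < n \<Longrightarrow> 0 < e i"
    and "\<And>i j. i < n \<Longrightarrow> j < n \<Longrightarrow> real_of_int (a i j) = b i j * (e i / e j)"
proof
  \<comment> \<open>\<open>a i j * a j i = - (a i j)\<^sup>2 * d j / d i\<close> and likewise for \<open>b\<close>, so equal weights give
    \<open>(a i j / b i j)\<^sup>2 = (d i / d' i) / (d j / d' j)\<close>.\<close>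
  define e where "e i = sqrt (d i / d' i)" for i
  have d: "0 < d i" "0 < d' i" if "i < n" for i
    using that assms(1,2) by (auto simp: symmetrizer_def)
  show e_pos: "0 < e i" if "i < n" for i
    using d[OF that] by (simp add: e_def)
  \<comment> \<open>Both entries of the pair are handled at once: a negative entry
    \<open>a i j\<close> is covered by the second conjunct with \<open>i\<close> and
    \<open>j\<close> exchanged.\<close>
  have pos_case: "real_of_int (a i j) = b i j * (e i / e j) \<and> real_of_int (a j i) = b j i * (e j / e i)"
    if ij: "i < n" "j < n" and "0 < a i j" for i j
  proof -
    have b: "0 < b i j" and weight: "\<bar>a i j * a j i\<bar> = \<bar>b i j * b j i\<bar>"
      using arrows[OF ij] \<open>0 < a i j\<close> by auto
    have neg: "a j i < 0" "b j i < 0"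
      using symmetrizer_sgn[OF assms(1) ij] symmetrizer_sgn[OF assms(2) ij] b \<open>0 < a i j\<close>
      by (auto simp: sgn_if split: if_splits)
    have w: "a i j * a j i = b i j * b j i"
      using weight neg b \<open>0 < a i j\<close> by (simp add: abs_mult)
    have sa: "real_of_int (a i j) * d j = - (real_of_int (a j i) * d i)"
      and sb: "real_of_int (b i j) * d' j = - (real_of_int (b j i) * d' i)"
      using assms(1,2) ij unfolding symmetrizer_def
      by (metis of_int_minus of_int_mult)+
    have wr: "real_of_int (a i j) * a j i = real_of_int (b i j) * b j i"
      using w by (metis of_int_mult)
    have sq: "e i ^ 2 = d i / d' i" "e j ^ 2 = d j / d' j"
      using d[OF ij(1)] d[OF ij(2)] by (simp_all add: e_def)
    have dr: "0 < real_of_int (d i)" "0 < real_of_int (d j)" "0 < real_of_int (d' i)" "0 < real_of_int (d' j)"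
      using d ij by auto
    have "(real_of_int (a i j))\<^sup>2 * d j * d' i = real_of_int (a i j) * (real_of_int (a i j) * d j) * d' i"
      by (simp add: power2_eq_square)
    also have "\<dots> = - (real_of_int (a i j) * a j i) * d i * d' i" unfolding sa by simp
    also have "\<dots> = real_of_int (b i j) * - (real_of_int (b j i) * d' i) * d i" unfolding wr by simp
    also have "\<dots> = (real_of_int (b i j))\<^sup>2 * d' j * d i" unfolding sb[symmetric] by (simp add: power2_eq_square)
    finally have 1: "(real_of_int (a i j))\<^sup>2 * d j * d' i = (real_of_int (b i j))\<^sup>2 * d' j * d i" .
    have "(real_of_int (b i j) * (e i / e j))\<^sup>2 = (real_of_int (b i j))\<^sup>2 * (e i ^ 2 / e j ^ 2)"
      by (simp add: power_mult_distrib power_divide)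
    also have "\<dots> = (real_of_int (a i j))\<^sup>2"
      using 1 dr unfolding sq by (simp add: field_simps)
    finally have "(real_of_int (a i j))\<^sup>2 = (real_of_int (b i j) * (e i / e j))\<^sup>2" by simp
    then have eq: "real_of_int (a i j) = b i j * (e i / e j)"
      using \<open>0 < a i j\<close> b e_pos[OF ij(1)] e_pos[OF ij(2)]
      by (subst (asm) power2_eq_iff_nonneg) auto
    then have "real_of_int (b i j) * (e i / e j) * a j i = real_of_int (b i j) * b j i"
      using wr by simp
    then have "(e i / e j) * a j i = b j i"
      using b by (simp add: mult.assoc del: times_divide_eq_left times_divide_eq_right)
    then have "real_of_int (a j i) = b j i * (e j / e i)"
      using e_pos[OF ij(1)] e_pos[OF ij(2)] by (auto simp: field_simps)
    with eq show ?thesis by simp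
  qed
  fix i j assume ij: "i < n" "j < n"
  consider "0 < a i j" | "0 < a j i" | "a i j = 0"
    using symmetrizer_sgn[OF assms(1) ij]
    by (cases "a i j" "0::int" rule: linorder_cases) (auto simp: sgn_if split: if_splits)
  then show "real_of_int (a i j) = b i j * (e i / e j)"
  proof cases
    case 3
    then have "a j i = 0"
      using symmetrizer_sgn[OF assms(1) ij] by (simp add: sgn_0_0)
    then have "\<not> 0 < b i j" "\<not> 0 < b j i"
      using arrows[OF ij] arrows[OF ij(2,1)] 3 by auto
    then have "b i j = 0"
      using symmetrizer_sgn[OF assms(2) ij] by (auto simp: sgn_if split: if_splits)
    with 3 show ?thesis by simp
  qed (use pos_case ij in auto)
qed

section \<open>Mutation under diagonal conjugation and relabelling\<close>

text \<open>The factor \<open>r\<close> of the intermediate vertex cancels, so the correction scales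
  like the entry it is added to. This is why conjugation by a positive diagonal matrix commutes with
  mutation.\<close>

lemma mutation_term_scaling:
  fixes p q r x y :: real
  assumes "0 < p" "0 < q" "0 < r"
  shows "sgn (x * (p / r)) * max 0 (x * (p / r) * (y * (r / q))) = sgn x * max 0 (x * y) * (p / q)"
proof -
  have "x * (p / r) * (y * (r / q)) = x * y * (p / q)" using assms by simp
  moreover have "max 0 (x * y * (p / q)) = max 0 (x * y) * (p / q)"
    using assms by (auto simp: max_def zero_le_mult_iff mult_le_0_iff zero_le_divide_iff divide_le_0_iff)
  moreover have "sgn (x * (p / r)) = sgn x" using assms by (simp add: sgn_mult)
  ultimately show ?thesis by (simp only: mult.assoc)
qed

definition scaled_extension :: "nat \<Rightarrow> (nat \<Rightarrow> real) \<Rightarrow> int mat \<Rightarrow> int mat \<Rightarrow> bool" where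
  "scaled_extension n e M A \<longleftrightarrow> M \<in> carrier_mat (Suc n) n \<and> A \<in> carrier_mat n n \<and>
     (\<forall>i<n. 0 < e i) \<and>
     (\<forall>i<n. \<forall>j<n. real_of_int (M $$ (i, j)) = real_of_int (A $$ (i, j)) * (e i / e j))"

lemma real_of_int_mutate_nth:
  assumes "i < dim_row M" "j < dim_col M"
  shows "real_of_int (mutate k M $$ (i, j)) = (if i = k \<or> j = k then - real_of_int (M $$ (i, j))
     else real_of_int (M $$ (i, j)) + sgn (real_of_int (M $$ (i, k))) *
       max 0 (real_of_int (M $$ (i, k)) * real_of_int (M $$ (k, j))))"
proof -
  have "real_of_int (sgn x) = sgn (real_of_int x)" for x by (simp add: sgn_if)
  then show ?thesis using assms by (simp add: mutate_nth of_int_max)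
qed

lemma scaled_extension_mutate:
  assumes "scaled_extension n e M A" "k < n"
  shows "scaled_extension n e (mutate k M) (mutate k A)"
  unfolding scaled_extension_def
proof (intro conjI allI impI)
  fix i j assume ij: "i < n" "j < n"
  have dims: "dim_row M = Suc n" "dim_col M = n" "dim_row A = n" "dim_col A = n"
    and e: "0 < e i" "0 < e j" "0 < e k"
    and M: "\<And>i j. i < n \<Longrightarrow> j < n \<Longrightarrow> real_of_int (M $$ (i, j)) = real_of_int (A $$ (i, j)) * (e i / e j)"
    using assms ij by (auto simp: scaled_extension_def)
  show "real_of_int (mutate k M $$ (i, j)) = real_of_int (mutate k A $$ (i, j)) * (e i / e j)"
    using ij dims M assms(2) mutation_term_scaling[OF e]
    by (simp add: real_of_int_mutate_nth distrib_right del: times_divide_eq_right)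
qed (use assms in \<open>auto simp: scaled_extension_def\<close>)

definition models :: "nat \<Rightarrow> (nat \<Rightarrow> nat) \<Rightarrow> (nat \<Rightarrow> real) \<Rightarrow> int mat \<Rightarrow> real list list \<Rightarrow> bool" where
  "models n \<pi> e M L \<longleftrightarrow> M \<in> carrier_mat (Suc n) n \<and> length L = Suc n \<and>
     bij_betw \<pi> {..<n} {..<n} \<and> \<pi> n = n \<and> (\<forall>i\<le>n. 0 < e i) \<and> e n = 1 \<and>
     (\<forall>i\<le>n. \<forall>j<n. L ! i ! j = real_of_int (M $$ (\<pi> i, \<pi> j)) * (e i / e j))"

lemma models_mutate:
  assumes "models n \<pi> e M L" "k < n"
  shows "models n \<pi> e (mutate (\<pi> k) M) (mut_rows k L)"
  unfolding models_def
proof (intro conjI allI impI)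
  fix i j assume ij: "i \<le> n" "j < n"
  have dims: "dim_row M = Suc n" "dim_col M = n" "length L = Suc n"
    and bij: "bij_betw \<pi> {..<n} {..<n}" "\<pi> n = n"
    and e: "0 < e i" "0 < e j" "0 < e k"
    and L: "\<And>i j. i \<le> n \<Longrightarrow> j < n \<Longrightarrow> L ! i ! j = real_of_int (M $$ (\<pi> i, \<pi> j)) * (e i / e j)"
    using assms ij by (auto simp: models_def)
  have lt: "\<pi> m < n" if "m < n" for m
    using bij(1) that by (auto simp: bij_betw_def)
  have \<pi>: "\<pi> i < Suc n" "\<pi> j < n" "\<pi> k < n"
    using lt[of i] lt[OF ij(2)] lt[OF assms(2)] ij(1) bij(2) by (cases "i = n"; simp)+
  have "\<pi> i = \<pi> k \<longleftrightarrow> i = k" if "i < n" for i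
    using bij_betw_imp_inj_on[OF bij(1)] that assms(2) by (simp add: inj_on_eq_iff)
  then have inj: "\<pi> i = \<pi> k \<longleftrightarrow> i = k" "\<pi> j = \<pi> k \<longleftrightarrow> j = k"
    using ij assms(2) bij(2) \<pi>(3) by (cases "i = n"; simp)+
  \<comment> \<open>Identifies the sign-split correction of \<open>mut_rows\<close> with the one in
    \<open>mutate\<close>.\<close>
  have entry: "(if 0 < y then y * max 0 x else - (y * min 0 x)) = sgn x * max 0 (x * y)" for x y :: real
    by (auto simp: sgn_if max_def min_def zero_le_mult_iff mult_le_0_iff)
  have "mut_rows k L ! i ! j = (if i = k \<or> j = k then - L ! i ! j
      else L ! i ! j + sgn (L ! i ! k) * max 0 (L ! i ! k * L ! k ! j))"
    using ij dims(3) by (simp add: mut_rows_nth entry del: upt_Suc)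
  also have "\<dots> = real_of_int (mutate (\<pi> k) M $$ (\<pi> i, \<pi> j)) * (e i / e j)"
    using ij dims L assms(2) mutation_term_scaling[OF e] \<pi> inj
    by (simp add: real_of_int_mutate_nth distrib_right del: times_divide_eq_right)
  finally show "mut_rows k L ! i ! j = real_of_int (mutate (\<pi> k) M $$ (\<pi> i, \<pi> j)) * (e i / e j)" .
qed (use assms in \<open>auto simp: models_def\<close>)

lemma mutation_class_trans:
  assumes "A \<in> mutation_class B" "B \<in> mutation_class M"
  shows "A \<in> mutation_class M"
  using assms by (induction rule: mutation_class.induct) (auto intro: mutation_class.step)

lemma models_fold:
  assumes "models n \<pi> e M L" "set ks \<subseteq> {..<n}"
  shows "\<exists>N \<in> mutation_class M. models n \<pi> e N (fold mut_rows ks L)"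
  using assms
proof (induction ks arbitrary: M L)
  case Nil
  then show ?case by (auto intro: mutation_class.self)
next
  case (Cons k ks)
  have "\<pi> k < dim_col M"
    using Cons.prems by (auto simp: models_def bij_betw_def)
  then have "mutate (\<pi> k) M \<in> mutation_class M"
    by (intro mutation_class.step mutation_class.self)
  moreover obtain N where "N \<in> mutation_class (mutate (\<pi> k) M)"
      "models n \<pi> e N (fold mut_rows ks (mut_rows k L))"
    using Cons.IH[OF models_mutate[OF Cons.prems(1)]] Cons.prems(2) by auto
  ultimately show ?case by (auto intro: mutation_class_trans)
qed

text \<open>Every list of rows reached from \<open>L\<close> models a member of the finite class, so
  its frozen entries lie in one finite set of rescaled integers.\<close>

lemma models_row_bounded:
  assumes "models n \<pi> e M L" "finite (mutation_class M)"
  shows "\<exists>C. row_bounded C L"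
proof -
  define S where "S = (\<lambda>(N, j). \<bar>real_of_int (N $$ (n, \<pi> j)) * (1 / e j)\<bar>) ` (mutation_class M \<times> {..<n})"
  have fin: "finite S" using assms(2) by (simp add: S_def)
  have len: "length L = Suc n" using assms(1) by (simp add: models_def)
  have "row_bounded (Max S) L"
    unfolding row_bounded_def len
  proof (intro allI impI)
    fix ks j assume "set ks \<subseteq> {..<Suc n - 1}" "j < Suc n - 1"
    then obtain N where N: "N \<in> mutation_class M" "models n \<pi> e N (fold mut_rows ks L)" and j: "j < n"
      using models_fold[OF assms(1), of ks] by auto
    have "fold mut_rows ks L ! n ! j = real_of_int (N $$ (n, \<pi> j)) * (1 / e j)"
      using N(2) j by (simp add: models_def)
    then have "\<bar>fold mut_rows ks L ! n ! j\<bar> \<in> S"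
      unfolding S_def using N(1) j by (intro image_eqI[of _ _ "(N, j)"]) auto
    then show "\<bar>fold mut_rows ks L ! (Suc n - 1) ! j\<bar> \<le> Max S"
      using fin by simp
  qed
  then show ?thesis ..
qed

section \<open>Transport back along a mutation sequence\<close>

lemma zero_last_row_mutate:
  assumes "M \<in> carrier_mat (Suc n) n" "k < n" "\<forall>j<n. M $$ (n, j) = 0"
  shows "\<forall>j<n. mutate k M $$ (n, j) = 0"
  using assms by (auto simp: mutate_nth)

text \<open>Mutations are involutions, so a mutation sequence leading from \<open>B\<close> to \<open>A\<close> can be run
  backwards on any extension of a rescaling of \<open>A\<close>.\<close>

lemma scaled_extension_back:
  assumes "A \<in> mutation_class B" "B \<in> carrier_mat n n" "scaled_extension n e M A"
  shows "\<exists>N \<in> mutation_class M. scaled_extension n e N B \<and>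
    ((\<forall>j<n. N $$ (n, j) = 0) \<longrightarrow> (\<forall>j<n. M $$ (n, j) = 0))"
  using assms(1,3)
proof (induction arbitrary: M rule: mutation_class.induct)
  case self
  then show ?case by (blast intro: mutation_class.self)
next
  case (step A k)
  have dims: "dim_row A = n" "dim_col A = n" "M \<in> carrier_mat (Suc n) n"
    using step.prems by (auto simp: scaled_extension_def)
  then have k: "k < n" using step.hyps by simp
  \<comment> \<open>\<open>M\<close> extends a rescaling of \<open>mutate k A\<close>; mutating it
    at \<open>k\<close> undoes the last mutation of the sequence.\<close>
  have "scaled_extension n e (mutate k M) A"
    using scaled_extension_mutate[OF step.prems k] mutate_involutive[of k A] dims k by simp
  from step.IH[OF this] obtain N where N: "N \<in> mutation_class (mutate k M)" "scaled_extension n e N B"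
    "(\<forall>j<n. N $$ (n, j) = 0) \<longrightarrow> (\<forall>j<n. mutate k M $$ (n, j) = 0)" by auto
  have "mutate k M \<in> mutation_class M"
    using dims k by (intro mutation_class.step mutation_class.self) auto
  then have "N \<in> mutation_class M" using N(1) mutation_class_trans by blast
  moreover have "mutate k M \<in> carrier_mat (Suc n) n" "mutate k (mutate k M) = M"
    using dims(3) k mutate_involutive[of k M] by auto
  then have "\<forall>j<n. M $$ (n, j) = 0" if "\<forall>j<n. mutate k M $$ (n, j) = 0"
    using zero_last_row_mutate[of "mutate k M" n k] that k by simp
  ultimately show ?case using N by blast
qed

lemma symmetrizer_mutation_class:
  assumes "A \<in> mutation_class B" "B \<in> carrier_mat n n" "symmetrizer n d (\<lambda>i j. B $$ (i, j))"
  shows "A \<in> carrier_mat n n \<and> symmetrizer n d (\<lambda>i j. A $$ (i, j))"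
  using assms
proof (induction rule: mutation_class.induct)
  case (step A k)
  then have "A \<in> carrier_mat n n" "symmetrizer n d (\<lambda>i j. A $$ (i, j))" "k < n" by auto
  then show ?case using symmetrizer_mutate[of n d A k] by auto
qed auto

section \<open>From a rigid representative to its whole class\<close>

lemma diagram_of_arrow_iff:
  "(i, j, w) \<in> snd (diagram_of B) \<longleftrightarrow> i < dim_row B \<and> j < dim_row B \<and> 0 < B $$ (i, j) \<and>
     w = \<bar>B $$ (i, j) * B $$ (j, i)\<bar>"
  by (auto simp: diagram_of_def)

lemma diagram_mutation_class_not_admissible:
  fixes R :: "int list list"
  assumes "rigid R" "length R = n" "\<forall>r \<in> set R. length r = n"
    and sym: "symmetrizer n dR (\<lambda>i j. R ! i ! j)"
    and S: "S = (\<Union>i<n. \<Union>j<n. if 0 < R ! i ! j then {(i, j, \<bar>R ! i ! j * R ! j ! i\<bar>)} else {})"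
    and "\<Gamma> \<in> diagram_mutation_class (n, S)" "skew_symmetrizable B" "diagram_of B = \<Gamma>"
  shows "\<not> admissible B b"
proof
  assume adm: "admissible B b"
  have arrows: "(i, j, w) \<in> S \<longleftrightarrow> 0 < R ! i ! j \<and> w = \<bar>R ! i ! j * R ! j ! i\<bar>"
    if "i < n" "j < n" for i j w
    using that unfolding S by (auto split: if_splits)
  obtain A B0 where A: "\<Gamma> = diagram_of A" "skew_symmetrizable B0"
      "diagram_iso (diagram_of B0) (n, S)" "A \<in> mutation_class B0"
    using assms(6) by (auto simp: diagram_mutation_class_def)
  obtain \<rho> where \<rho>: "bij_betw \<rho> {..<dim_row B0} {..<n}"
      "S = (\<lambda>(i, j, w). (\<rho> i, \<rho> j, w)) ` snd (diagram_of B0)"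
    using A(3) by (auto simp: diagram_iso_def diagram_of_def)
  then have "dim_row B0 = n" using bij_betw_same_card by fastforce
  with skew_symmetrizable_symmetrizer[OF A(2)] obtain d0 where
    B0: "B0 \<in> carrier_mat n n" "symmetrizer n d0 (\<lambda>i j. B0 $$ (i, j))"
    by (metis carrier_matI)
  then have Asym: "A \<in> carrier_mat n n" "symmetrizer n d0 (\<lambda>i j. A $$ (i, j))"
    using symmetrizer_mutation_class[OF A(4)] by auto
  have "dim_row B = n"
    using arg_cong[OF trans[OF assms(8) A(1)], of fst] Asym(1) by (simp add: diagram_of_def)
  with skew_symmetrizable_symmetrizer[OF assms(7)] obtain d where
    B: "B \<in> carrier_mat n n" "symmetrizer n d (\<lambda>i j. B $$ (i, j))"
    by (metis carrier_matI)
  have "(0 < B $$ (i, j) \<and> w = \<bar>B $$ (i, j) * B $$ (j, i)\<bar>) \<longleftrightarrow>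
      (0 < A $$ (i, j) \<and> w = \<bar>A $$ (i, j) * A $$ (j, i)\<bar>)" if "i < n" "j < n" for i j w
    using diagram_of_arrow_iff[of i j w B] diagram_of_arrow_iff[of i j w A] that B(1) Asym(1)
      assms(8) A(1) by simp
  then obtain e where e: "\<And>i. i < n \<Longrightarrow> 0 < e i"
    "\<And>i j. i < n \<Longrightarrow> j < n \<Longrightarrow> real_of_int (B $$ (i, j)) = A $$ (i, j) * (e i / e j)"
    using symmetrizer_scaling[OF B(2) Asym(2)] by blast
  define M where "M = B @\<^sub>r mat_of_row (- b)"
  have b: "b \<in> carrier_vec n" "b \<noteq> 0\<^sub>v n" "finite (mutation_class M)"
    using adm B(1) by (auto simp: admissible_def M_def)
  have M: "M \<in> carrier_mat (Suc n) n"
    using carrier_append_rows[OF B(1), of "mat_of_row (- b)" 1] b(1) by (simp add: M_def mat_of_row_carrier)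
  have M_nth: "M $$ (i, j) = (if i < n then B $$ (i, j) else - b $ j)" if "i < Suc n" "j < n" for i j
    using that B(1) b(1) by (auto simp: M_def append_rows_def mat_of_row_def)
  have "scaled_extension n e M A"
    using M Asym(1) e M_nth by (auto simp: scaled_extension_def)
  from scaled_extension_back[OF A(4) B0(1) this] obtain N where
    N: "N \<in> mutation_class M" "scaled_extension n e N B0"
      "(\<forall>j<n. N $$ (n, j) = 0) \<longrightarrow> (\<forall>j<n. M $$ (n, j) = 0)" by auto
  have finN: "finite (mutation_class N)"
    using b(3) N(1) mutation_class_trans by (auto intro: finite_subset)
  \<comment> \<open>\<open>\<sigma>\<close> sends vertices of the representative to those of
    \<open>B0\<close>.\<close>
  define \<sigma> where "\<sigma> = inv_into {..<n} \<rho>"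
  have \<rho>': "bij_betw \<rho> {..<n} {..<n}" using \<rho>(1) \<open>dim_row B0 = n\<close> by simp
  have \<sigma>: "bij_betw \<sigma> {..<n} {..<n}" using bij_betw_inv_into[OF \<rho>'] by (simp add: \<sigma>_def)
  have \<sigma>_lt: "\<sigma> i < n" if "i < n" for i using \<sigma> that by (auto simp: bij_betw_def)
  have \<rho>\<sigma>: "\<rho> (\<sigma> i) = i" if "i < n" for i
    using bij_betw_inv_into_right[OF \<rho>'] that by (simp add: \<sigma>_def)
  have \<sigma>\<rho>: "\<sigma> (\<rho> i) = i" if "i < n" for i
    using bij_betw_inv_into_left[OF \<rho>'] that by (simp add: \<sigma>_def)
  have S_iff: "(i, j, w) \<in> S \<longleftrightarrow> (\<sigma> i, \<sigma> j, w) \<in> snd (diagram_of B0)" if "i < n" "j < n" for i j w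
  proof
    assume "(i, j, w) \<in> S"
    then obtain i' j' where "(i', j', w) \<in> snd (diagram_of B0)" "i = \<rho> i'" "j = \<rho> j'"
      using \<rho>(2) by auto
    then show "(\<sigma> i, \<sigma> j, w) \<in> snd (diagram_of B0)"
      using \<sigma>\<rho> \<open>dim_row B0 = n\<close> by (simp add: diagram_of_arrow_iff)
  next
    assume "(\<sigma> i, \<sigma> j, w) \<in> snd (diagram_of B0)"
    then have "(\<rho> (\<sigma> i), \<rho> (\<sigma> j), w) \<in> S" using \<rho>(2) by force
    then show "(i, j, w) \<in> S" using \<rho>\<sigma> that by simp
  qed
  have sym\<sigma>: "symmetrizer n (\<lambda>i. d0 (\<sigma> i)) (\<lambda>i j. B0 $$ (\<sigma> i, \<sigma> j))"
    using B0(2) \<sigma>_lt unfolding symmetrizer_def by blast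
  have "(0 < R ! i ! j \<and> w = \<bar>R ! i ! j * R ! j ! i\<bar>) \<longleftrightarrow>
      (0 < B0 $$ (\<sigma> i, \<sigma> j) \<and> w = \<bar>B0 $$ (\<sigma> i, \<sigma> j) * B0 $$ (\<sigma> j, \<sigma> i)\<bar>)" if "i < n" "j < n" for i j w
    using arrows[OF that, of w] S_iff[OF that, of w] \<sigma>_lt that \<open>dim_row B0 = n\<close>
    by (simp add: diagram_of_arrow_iff)
  then obtain f where f: "\<And>i. i < n \<Longrightarrow> 0 < f i"
    "\<And>i j. i < n \<Longrightarrow> j < n \<Longrightarrow> real_of_int (R ! i ! j) = B0 $$ (\<sigma> i, \<sigma> j) * (f i / f j)"
    using symmetrizer_scaling[OF sym sym\<sigma>] by blast
  \<comment> \<open>\<open>R\<close> is \<open>B0\<close> rescaled by \<open>f\<close>, and the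
    principal part of \<open>N\<close> is \<open>B0\<close> rescaled by \<open>e\<close>, so passing
    from \<open>N\<close> to \<open>R\<close> takes the quotient, read at the vertex
    \<open>\<sigma> i\<close>.\<close>
  define g where "g i = (if i < n then f i / e (\<sigma> i) else 1)" for i
  define \<pi> where "\<pi> i = (if i < n then \<sigma> i else i)" for i
  define xs where "xs = map (\<lambda>j. real_of_int (N $$ (n, \<pi> j)) * (1 / g j)) [0..<n]"
  define L where "L = map (map real_of_int) R @ [xs]"
  have N_nth: "real_of_int (N $$ (i, j)) = B0 $$ (i, j) * (e i / e j)" if "i < n" "j < n" for i j
    using N(2) that by (simp add: scaled_extension_def)
  have "models n \<pi> g N L"
    unfolding models_def
  proof (intro conjI allI impI)
    show "N \<in> carrier_mat (Suc n) n" using N(2) by (simp add: scaled_extension_def)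
    show "length L = Suc n" using assms(2) by (simp add: L_def)
    show "bij_betw \<pi> {..<n} {..<n}"
      using \<sigma> by (rule bij_betw_cong[THEN iffD1, rotated]) (simp add: \<pi>_def)
    show "\<pi> n = n" "g n = 1" by (auto simp: \<pi>_def g_def)
    show "0 < g i" for i using f(1) e(1) \<sigma>_lt by (simp add: g_def)
    fix i j assume "i \<le> n" and j: "j < n"
    show "L ! i ! j = real_of_int (N $$ (\<pi> i, \<pi> j)) * (g i / g j)"
    proof (cases "i < n")
      case True
      have pos: "0 < f i" "0 < f j" "0 < e (\<sigma> i)" "0 < e (\<sigma> j)" using f(1) e(1) \<sigma>_lt True j by auto
      have "L ! i ! j = real_of_int (R ! i ! j)"
        using assms(2,3) True j by (simp add: L_def nth_append)
      then show ?thesis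
        using f(2)[OF True j] N_nth[OF \<sigma>_lt[OF True] \<sigma>_lt[OF j]] pos True j
        by (simp add: g_def \<pi>_def)
    next
      case False
      then show ?thesis
        using \<open>i \<le> n\<close> j assms(2) by (simp add: L_def nth_append xs_def \<pi>_def g_def)
    qed
  qed
  then obtain C where "row_bounded C L" using models_row_bounded finN by blast
  moreover have "length xs = length R" using assms(2) by (simp add: xs_def)
  ultimately have "\<forall>x \<in> set xs. x = 0" using assms(1) unfolding rigid_def L_def by blast
  then have zero: "N $$ (n, \<sigma> j) = 0" if "j < n" for j
    using that f(1) e(1) \<sigma>_lt by (fastforce simp: xs_def g_def \<pi>_def)
  \<comment> \<open>Every column index has the form \<open>\<sigma> (\<rho> j)\<close>.\<close>
  have "N $$ (n, j) = 0" if "j < n" for j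
  proof -
    have "\<rho> j < n" using \<rho>' that by (auto simp: bij_betw_def)
    then show ?thesis using zero[of "\<rho> j"] \<sigma>\<rho>[OF that] by simp
  qed
  then have "\<forall>j<n. M $$ (n, j) = 0" using N(3) by blast
  then have "b = 0\<^sub>v n" using M_nth b(1) by (intro eq_vecI) auto
  with b(2) show False by simp
qed

section \<open>Application to the four classes\<close>

theorem theorem9p7:
  fixes \<Gamma> :: diagram and B :: "int mat"
  assumes "\<Gamma> \<in> G2_star_plus \<union> G2_star_star \<union> F4_star_plus \<union> F4_star_star"
    and "skew_symmetrizable B"
    and "diagram_of B = \<Gamma>"
  shows "\<not> (\<exists>b. admissible B b)"
proof -
  consider "\<Gamma> \<in> G2_star_plus" | "\<Gamma> \<in> G2_star_star" | "\<Gamma> \<in> F4_star_plus" | "\<Gamma> \<in> F4_star_star"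
    using assms(1) by blast
  then show ?thesis
  proof cases
    case 1
    \<comment> \<open>In all four cases \<open>dR\<close> is read off from the representative along
      its arrows: the ratio of its values at \<open>i\<close> and \<open>j\<close> is
      \<open>R ! i ! j\<close> divided by \<open>- R ! j ! i\<close>.\<close>
    have "\<not> admissible B b" for b
      by (rule diagram_mutation_class_not_admissible[OF rigid_G2_star_plus, where n = 4
            and dR = "\<lambda>i. [3, 3, 1, 1] ! i", OF _ _ _ _ 1[unfolded G2_star_plus_def] assms(2,3)])
        (auto simp: symmetrizer_def All_less_Suc numeral_eq_Suc lessThan_Suc)
    then show ?thesis by blast
  next
    case 2
    have "\<not> admissible B b" for b
      by (rule diagram_mutation_class_not_admissible[OF rigid_G2_star_star, where n = 4
            and dR = "\<lambda>i. [3, 3, 3, 1] ! i", OF _ _ _ _ 2[unfolded G2_star_star_def] assms(2,3)])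
        (auto simp: symmetrizer_def All_less_Suc numeral_eq_Suc lessThan_Suc)
    then show ?thesis by blast
  next
    case 3
    have "\<not> admissible B b" for b
      by (rule diagram_mutation_class_not_admissible[OF rigid_F4_star_plus, where n = 6
            and dR = "\<lambda>i. [2, 2, 2, 1, 1, 1] ! i", OF _ _ _ _ 3[unfolded F4_star_plus_def] assms(2,3)])
        (auto simp: symmetrizer_def All_less_Suc numeral_eq_Suc lessThan_Suc)
    then show ?thesis by blast
  next
    case 4
    have "\<not> admissible B b" for b
      by (rule diagram_mutation_class_not_admissible[OF rigid_F4_star_star, where n = 6
            and dR = "\<lambda>i. [2, 2, 2, 2, 1, 1] ! i", OF _ _ _ _ 4[unfolded F4_star_star_def] assms(2,3)])
        (auto simp: symmetrizer_def All_less_Suc numeral_eq_Suc lessThan_Suc)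
    then show ?thesis by blast
  qed
qed

end
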